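(* Let $A\in\mathbb{R}^{m\times n}$ be nonzero and $b\in\mathbb{R}^m$. Let $\mathcal{D}$ be a distribution of random matrix quadruples $(S_1,S_2,T_1,T_2)$ satisfying $\mathbb{E}[T_1T_2^\top A^\top S_1S_2^\top]=\frac{A^\top}{\|A\|_F^2}$. Let $x^0\in\mathbb{R}^n$ be an arbitrary (deterministic) initial vector, let $x^0_*=A^{\dagger}b+(I-A^\dagger A)x^0$, and let $\{x^k\}$ be generated by the PFR iteration $$x^{k+1}=x^{k}-\alpha T_1T_2^\top A^\top S_1S_2^\top(Ax^{k}-b),\qquad k\ge 0,$$ where at each iteration a fresh quadruple $(S_1,S_2,T_1,T_2)$ is drawn independently from $\mathcal{D}$. If $0<\alpha\leq \frac{\|A\|^2_F}{\sigma_{\max}^2(A)}$, then for every $k\ge 1$ $$\left\|\mathbb{E}\left[x^k-x^0_*\right]\right\|^2_2\leq\left(1-\alpha\frac{\sigma_{\min}^2(A)}{\|A\|^2_F}\right)^{2k}\left\|x^0-x^0_*\right\|^2_2.$$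
   Context: $A^\dagger$ is the Moore-Penrose pseudoinverse; $\|\cdot\|_F$ is the Frobenius norm; $\|\cdot\|_2$ is the Euclidean norm; $\sigma_{\max}(A)$ is the largest singular value and $\sigma_{\min}(A)$ the smallest nonzero singular value of $A$. The linear system $Ax=b$ may be consistent or inconsistent and $A$ may have any rank. The random matrices have sizes $S_1,S_2\in\mathbb{R}^{m\times p}$ and $T_1,T_2\in\mathbb{R}^{n\times s}$, where $p,s$ may themselves be random; the four matrices in a quadruple need not be independent of each other, but quadruples used at different iterations are independent and identically distributed. All expectations appearing are assumed to exist and be finite. *)

theory Defs
  imports "HOL-Probability.Probability"
begin

text \<open>
  Deterministic vectors and matrices are elements of \<open>real ^ 'n\<close> and \<open>real ^ 'n ^ 'm\<close>.  On the latter
  type, \<^const>\<open>norm\<close> is the Euclidean norm of the vector of Euclidean norms of the rows, that is, the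
  Frobenius norm.
\<close>

text \<open>The Penrose conditions determine \<open>X\<close> uniquely.\<close>

definition is_pinv :: "real ^ 'n ^ 'm \<Rightarrow> real ^ 'm ^ 'n \<Rightarrow> bool" where
  "is_pinv A X \<longleftrightarrow>
     A ** X ** A = A \<and> X ** A ** X = X \<and>
     transpose (A ** X) = A ** X \<and> transpose (X ** A) = X ** A"

definition pinv :: "real ^ 'n ^ 'm \<Rightarrow> real ^ 'm ^ 'n" where
  "pinv A = (THE X. is_pinv A X)"

text \<open>
  The square roots of the eigenvalues of \<open>A\<^sup>T A\<close>.  If \<open>A\<close> has more columns than rows, this set contains
  \<open>0\<close> even when \<open>A\<close> has full rank; that affects neither the largest nor the smallest nonzero element
  for \<open>A \<noteq> 0\<close>.
\<close>

definition singular_values :: "real ^ 'n ^ 'm \<Rightarrow> real set" where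
  "singular_values A = {sqrt l | l. \<exists>v. v \<noteq> 0 \<and> (transpose A ** A) *v v = l *\<^sub>R v}"

definition sigma_max :: "real ^ 'n ^ 'm \<Rightarrow> real" where
  "sigma_max A = Max (singular_values A)"

definition sigma_min :: "real ^ 'n ^ 'm \<Rightarrow> real" where
  "sigma_min A = Min (singular_values A - {0})"

text \<open>
  A matrix whose number of columns may be random is represented by the list of its columns, so that
  its number of columns is the length of the list.
\<close>

type_synonym 'm cols = "(real ^ 'm) list"

definition mult_transpose :: "'a cols \<Rightarrow> 'b cols \<Rightarrow> real ^ 'b ^ 'a" where
  "mult_transpose S S' = (\<chi> i j. \<Sum>l<length S. (S ! l) $ i * (S' ! l) $ j)"

text \<open>
  \<open>listset [B\<^sub>1, \<dots>, B\<^sub>p]\<close> is the set of all matrices with \<open>p\<close> columns, the \<open>l\<close>-th one in \<open>B\<^sub>l\<close>.  Hence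
  the following is the Borel sigma-algebra of the disjoint union over \<open>p\<close> of the spaces of matrices
  with \<open>p\<close> columns.
\<close>

definition cols_space :: "'m::finite cols measure" where
  "cols_space = sigma UNIV (listset ` lists (sets borel))"

type_synonym ('m, 'n) quad = "'m cols \<times> 'm cols \<times> 'n cols \<times> 'n cols"

definition quad_space :: "('m::finite, 'n::finite) quad measure" where
  "quad_space =
     restrict_space (cols_space \<Otimes>\<^sub>M cols_space \<Otimes>\<^sub>M cols_space \<Otimes>\<^sub>M cols_space)
       {(S\<^sub>1, S\<^sub>2, T\<^sub>1, T\<^sub>2). length S\<^sub>1 = length S\<^sub>2 \<and> length T\<^sub>1 = length T\<^sub>2}"

definition pfr_matrix :: "real ^ 'n ^ 'm \<Rightarrow> ('m, 'n) quad \<Rightarrow> real ^ 'm ^ 'n" where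
  "pfr_matrix A = (\<lambda>(S\<^sub>1, S\<^sub>2, T\<^sub>1, T\<^sub>2).
     mult_transpose T\<^sub>1 T\<^sub>2 ** transpose A ** mult_transpose S\<^sub>1 S\<^sub>2)"

primrec pfr ::
  "real ^ 'n ^ 'm \<Rightarrow> real ^ 'm \<Rightarrow> real \<Rightarrow> real ^ 'n \<Rightarrow> (nat \<Rightarrow> ('m, 'n) quad) \<Rightarrow> nat \<Rightarrow> real ^ 'n"
where
  "pfr A b \<alpha> x\<^sub>0 q 0 = x\<^sub>0"
| "pfr A b \<alpha> x\<^sub>0 q (Suc k) =
     pfr A b \<alpha> x\<^sub>0 q k - \<alpha> *\<^sub>R (pfr_matrix A (q k) *v (A *v pfr A b \<alpha> x\<^sub>0 q k - b))"

end

theory Submission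
  imports Defs
begin

text \<open>
  The quadruple drawn at step \<open>k\<close> is independent of \<open>x\<^sup>k\<close>, and \<open>A\<^sup>T (A x\<^sub>s - b) = 0\<close>; hence the mean error
  satisfies \<open>E (x\<^sup>k\<^sup>+\<^sup>1 - x\<^sub>s) = (I - c A\<^sup>T A) E (x\<^sup>k - x\<^sub>s)\<close> with \<open>c = \<alpha> / \<parallel>A\<parallel>\<^sub>F\<^sup>2\<close>.  The initial error
  \<open>x\<^sub>0 - x\<^sub>s = A\<^sup>\<dagger> (A x\<^sub>0 - b)\<close> lies in the row space of \<open>A\<close>, which is invariant under this map and on
  which the eigenvalues of \<open>I - c A\<^sup>T A\<close> lie in \<open>[0, 1 - c \<sigma>\<^sub>m\<^sub>i\<^sub>n\<^sup>2]\<close>.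
\<close>

section \<open>Adjoints and the Gram matrix\<close>

lemma inner_transpose:
  fixes A :: "real ^ 'n ^ 'm"
  shows "(transpose A *v y) \<bullet> x = y \<bullet> (A *v x)"
  by (metis dot_lmul_matrix transpose_matrix_vector)

lemma gram_mult_vec:
  fixes A :: "real ^ 'n ^ 'm"
  shows "(transpose A ** A) *v x = transpose A *v (A *v x)"
  by (simp add: matrix_vector_mul_assoc)

lemma gram_symmetric:
  fixes A :: "real ^ 'n ^ 'm"
  shows "((transpose A ** A) *v u) \<bullet> v = u \<bullet> ((transpose A ** A) *v v)"
  by (metis gram_mult_vec inner_commute inner_transpose)

lemma gram_eigenvector_inner:
  fixes A :: "real ^ 'n ^ 'm"
  assumes "(transpose A ** A) *v v = l *\<^sub>R v"
  shows "(A *v v) \<bullet> (A *v v) = l * (v \<bullet> v)"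
  using inner_transpose[of A "A *v v" v] assms by (simp add: gram_mult_vec)

lemma transpose_eqI:
  fixes B :: "real ^ 'n ^ 'n"
  assumes "\<And>x y. (B *v x) \<bullet> y = x \<bullet> (B *v y)"
  shows "transpose B = B"
proof -
  have "(transpose B *v x) \<bullet> y = (B *v x) \<bullet> y" for x y
    by (simp only: assms inner_transpose)
  then have "transpose B *v x = B *v x" for x
    using vector_eq_rdot by blast
  then show ?thesis
    by (simp add: matrix_eq)
qed

section \<open>The pseudoinverse and the row space\<close>

text \<open>Transposing \<open>A ** X = (A ** Y) ** (A ** X)\<close> reverses the symmetric factors,
  and \<open>A ** X ** A = A\<close> then collapses the product to \<open>A ** Y\<close>. The same
  argument on the other side gives \<open>X ** A = Y ** A\<close>, and the two identities turn
  \<open>X ** A ** X\<close> into \<open>Y ** A ** Y\<close>.\<close>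

lemma is_pinv_unique:
  fixes A :: "real ^ 'n ^ 'm"
  assumes X: "is_pinv A X" and Y: "is_pinv A Y"
  shows "X = Y"
proof -
  have AX: "A ** X = (A ** Y) ** (A ** X)" and XA: "X ** A = (X ** A) ** (Y ** A)"
    using X Y by (metis is_pinv_def matrix_mul_assoc)+
  have "A ** X = transpose ((A ** Y) ** (A ** X))"
    using X AX by (metis is_pinv_def)
  also have "\<dots> = (A ** X) ** (A ** Y)"
    using X Y by (simp add: matrix_transpose_mul is_pinv_def)
  also have "\<dots> = A ** Y"
    using X by (metis is_pinv_def matrix_mul_assoc)
  finally have 1: "A ** X = A ** Y" .
  have "X ** A = transpose ((X ** A) ** (Y ** A))"
    using X XA by (metis is_pinv_def)
  also have "\<dots> = (Y ** A) ** (X ** A)"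
    using X Y by (simp add: matrix_transpose_mul is_pinv_def)
  also have "\<dots> = Y ** A"
    using X by (metis is_pinv_def matrix_mul_assoc)
  finally have 2: "X ** A = Y ** A" .
  show ?thesis
    using X Y 1 2 by (metis is_pinv_def matrix_mul_assoc)
qed

lemma subspace_row_range:
  fixes A :: "real ^ 'n ^ 'm"
  shows "subspace (range ((*v) (transpose A)))"
  by (intro linear_subspace_image matrix_vector_mul_linear subspace_UNIV)

text \<open>The squared norm of \<open>A *v v\<close> is the inner product of \<open>v\<close> with
  its image under the Gram matrix.\<close>

lemma gram_eq_0_iff:
  fixes A :: "real ^ 'n ^ 'm"
  shows "(transpose A ** A) *v v = 0 \<longleftrightarrow> A *v v = 0"
proof
  assume "(transpose A ** A) *v v = 0"
  then have "(A *v v) \<bullet> (A *v v) = 0"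
    by (metis gram_mult_vec inner_transpose inner_zero_left)
  then show "A *v v = 0" by simp
qed (simp add: gram_mult_vec)

text \<open>The row space is orthogonal to the kernel: for \<open>v = transpose A *v y\<close>,
  moving the transpose across gives \<open>v \<bullet> v = y \<bullet> (A *v v)\<close>.\<close>

lemma row_range_kernel:
  fixes A :: "real ^ 'n ^ 'm"
  assumes "v \<in> range ((*v) (transpose A))" and "A *v v = 0"
  shows "v = 0"
proof -
  obtain y where y: "v = transpose A *v y"
    using assms(1) by blast
  have "v \<bullet> v = y \<bullet> (A *v v)"
    by (subst (1) y) (rule inner_transpose)
  then show "v = 0"
    using assms(2) by simp
qed

text \<open>
  The Gram matrix \<open>A\<^sup>T A\<close> restricts to a bijection of the row space of \<open>A\<close>; if \<open>h\<close> is the inverse of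
  this bijection, then \<open>h A\<^sup>T\<close> is the pseudoinverse.
\<close>

lemma is_pinv_exists:
  fixes A :: "real ^ 'n ^ 'm"
  shows "\<exists>X. is_pinv A X"
proof -
  define V where "V = range ((*v) (transpose A))"
  define K where "K = transpose A ** A"
  have subV: "subspace V"
    unfolding V_def by (rule subspace_row_range)
  have KV: "K *v v \<in> V" and AV: "transpose A *v y \<in> V" for v y
    by (auto simp: K_def V_def gram_mult_vec)
  have K_sym: "(K *v u) \<bullet> v = u \<bullet> (K *v v)" for u v
    unfolding K_def by (rule gram_symmetric)
  have inj: "inj_on ((*v) K) V"
  proof (rule inj_onI)
    fix u v assume uv: "u \<in> V" "v \<in> V" "K *v u = K *v v"
    then have "u - v \<in> V" and "K *v (u - v) = 0"
      by (simp_all add: subspace_diff[OF subV] matrix_vector_mult_diff_distrib)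
    then have "u - v = 0"
      unfolding K_def V_def gram_eq_0_iff by (rule row_range_kernel)
    then show "u = v" by simp
  qed
  have "(*v) K ` V \<subseteq> V"
    using KV by blast
  moreover have "dim ((*v) K ` V) = dim V"
  proof (rule dim_image_eq)
    have "span V = V"
      using subV by (simp only: span_eq_iff)
    then show "inj_on ((*v) K) (span V)"
      using inj by (simp only:)
  qed simp
  ultimately have surj: "(*v) K ` V = V"
    using subV
    by (intro subspace_dim_equal linear_subspace_image matrix_vector_mul_linear) auto
  obtain h where h: "range h \<subseteq> V" "linear h" "\<And>v. v \<in> V \<Longrightarrow> h (K *v v) = v"
    using linear_exists_left_inverse_on[OF matrix_vector_mul_linear subV inj] by auto
  \<comment> \<open>Since \<open>K\<close> maps \<open>V\<close> onto itself, the left inverse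
    \<open>h\<close> is also a right inverse on \<open>V\<close>.\<close>
  have Kh: "K *v h w = w" if w: "w \<in> V" for w
    using surj w h(3) by (metis (no_types, lifting) imageE)
  \<comment> \<open>Substitute \<open>u = K *v h u\<close> and \<open>v = K *v h v\<close>, then
    move the symmetric \<open>K\<close> across.\<close>
  have h_sym: "h u \<bullet> v = u \<bullet> h v" if "u \<in> V" "v \<in> V" for u v
    using that Kh K_sym by metis
  define H where "H = matrix h"
  have H: "H *v v = h v" for v
    unfolding H_def by (metis h(2) matrix_vector_mul(2))
  define X where "X = H ** transpose A"
  have X: "X *v y = h (transpose A *v y)" for y
    by (simp add: X_def H flip: matrix_vector_mul_assoc)
  have XA: "X *v (A *v v) = h (K *v v)" for v
    by (simp add: X K_def gram_mult_vec)
  have KhK: "K *v h (K *v v) = K *v v" for v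
    using Kh KV by blast
  \<comment> \<open>\<open>K\<close> and \<open>A\<close> have the same kernel, so
    \<open>KhK\<close> remains true with the outer \<open>K\<close> replaced by
    \<open>A\<close>.\<close>
  have AXA: "A *v h (K *v v) = A *v v" for v
  proof -
    have "(transpose A ** A) *v (h (K *v v) - v) = 0"
      using KhK[of v] by (simp add: K_def[symmetric] matrix_vector_mult_diff_distrib)
    then have "A *v (h (K *v v) - v) = 0"
      by (simp only: gram_eq_0_iff)
    then show ?thesis
      by (simp add: matrix_vector_mult_diff_distrib)
  qed
  have "A ** X ** A = A"
    by (simp add: matrix_eq XA AXA flip: matrix_vector_mul_assoc)
  moreover have "X ** A ** X = X"
  proof -
    have "h (K *v h (transpose A *v y)) = h (transpose A *v y)" for y
      using Kh AV by simp
    then show ?thesis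
      by (simp add: matrix_eq XA flip: matrix_vector_mul_assoc) (simp add: X)
  qed
  moreover have "transpose (A ** X) = A ** X"
  proof (rule transpose_eqI)
    fix y z
    have "(A *v h (transpose A *v y)) \<bullet> z = h (transpose A *v y) \<bullet> (transpose A *v z)"
      by (metis inner_commute inner_transpose)
    also have "\<dots> = (transpose A *v y) \<bullet> h (transpose A *v z)"
      using AV h_sym by blast
    also have "\<dots> = y \<bullet> (A *v h (transpose A *v z))"
      by (rule inner_transpose)
    finally show "((A ** X) *v y) \<bullet> z = y \<bullet> ((A ** X) *v z)"
      by (simp add: X flip: matrix_vector_mul_assoc)
  qed
  moreover have "transpose (X ** A) = X ** A"
  proof (rule transpose_eqI)
    fix v w
    \<comment> \<open>The map \<open>v \<mapsto> h (K *v v)\<close> is the orthogonal projection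
      onto \<open>V\<close>. The right-hand side is symmetric in \<open>v\<close> and
      \<open>w\<close>, which yields the symmetry of \<open>X ** A\<close>.\<close>
    have "h (K *v v) \<bullet> w = h (K *v v) \<bullet> h (K *v w)" for v w
    proof -
      have "h (K *v v) \<in> V"
        using h(1) by blast
      then have "h (K *v v) \<bullet> w = (K *v h (h (K *v v))) \<bullet> w"
        by (simp add: Kh)
      also have "\<dots> = h (h (K *v v)) \<bullet> (K *v h (K *v w))"
        by (simp add: K_sym KhK)
      also have "\<dots> = h (K *v v) \<bullet> h (K *v w)"
        using Kh \<open>h (K *v v) \<in> V\<close> by (metis K_sym)
      finally show ?thesis .
    qed
    then have "h (K *v v) \<bullet> w = v \<bullet> h (K *v w)"
      by (metis inner_commute)
    then show "((X ** A) *v v) \<bullet> w = v \<bullet> ((X ** A) *v w)"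
      by (simp add: XA flip: matrix_vector_mul_assoc)
  qed
  ultimately show ?thesis
    unfolding is_pinv_def by blast
qed

lemma is_pinv_pinv:
  fixes A :: "real ^ 'n ^ 'm"
  shows "is_pinv A (pinv A)"
  unfolding pinv_def using is_pinv_exists is_pinv_unique by (metis theI)

text \<open>These are the normal equations, valid also for inconsistent systems: as
  \<open>A ** pinv A\<close> is symmetric, multiplying it by \<open>transpose A\<close> gives the
  transpose of \<open>A ** pinv A ** A = A\<close>.\<close>

lemma transpose_pinv_residual:
  fixes A :: "real ^ 'n ^ 'm"
  shows "transpose A *v (A *v (pinv A *v b) - b) = 0"
proof -
  let ?P = "pinv A"
  have "transpose A ** (A ** ?P) = transpose (A ** ?P ** A)"
    using is_pinv_pinv[of A] by (metis is_pinv_def matrix_transpose_mul)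
  also have "\<dots> = transpose A"
    using is_pinv_pinv[of A] by (simp add: is_pinv_def)
  finally show ?thesis
    by (simp add: matrix_vector_mult_diff_distrib matrix_vector_mul_assoc matrix_mul_assoc)
qed

text \<open>Replacing \<open>pinv A ** A\<close> by its transpose in
  \<open>pinv A ** A ** pinv A\<close> brings the factor \<open>transpose A\<close> to the
  front.\<close>

lemma pinv_in_row_range:
  fixes A :: "real ^ 'n ^ 'm"
  shows "pinv A *v y \<in> range ((*v) (transpose A))"
proof -
  let ?P = "pinv A"
  have "?P = transpose (?P ** A) ** ?P"
    using is_pinv_pinv[of A] by (simp add: is_pinv_def)
  then have "?P = transpose A ** (transpose ?P ** ?P)"
    by (simp add: matrix_transpose_mul matrix_mul_assoc)
  then show ?thesis
    by (metis matrix_vector_mul_assoc rangeI)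
qed

section \<open>Symmetric maps on invariant subspaces\<close>

text \<open>The first-order condition at the minimum \<open>t = 0\<close>: a nonzero linear term
  outweighs the quadratic one for small \<open>t\<close> of the opposite sign to
  \<open>a\<close>.\<close>

lemma quadratic_nonneg_imp_linear_coeff_0:
  fixes a c :: real
  assumes "\<And>t. 0 \<le> 2 * t * a + t\<^sup>2 * c"
  shows "a = 0"
proof (rule ccontr)
  assume "a \<noteq> 0"
  \<comment> \<open>As \<open>d\<close> is positive and at least \<open>c\<close>, at
    \<open>t = - a / d\<close> the quadratic term is at most \<open>a\<^sup>2 / d\<close>, half of
    what the linear term subtracts.\<close>
  define d where "d = \<bar>c\<bar> + 1"
  have "0 \<le> 2 * (- a / d) * a + (- a / d)\<^sup>2 * c"
    by (rule assms)
  also have "\<dots> \<le> 2 * (- a / d) * a + (- a / d)\<^sup>2 * d"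
    by (intro add_left_mono mult_left_mono) (auto simp: d_def)
  also have "\<dots> = - a\<^sup>2 / d"
  proof -
    have "d \<noteq> 0"
      unfolding d_def by linarith
    then show ?thesis
      by (simp add: power2_eq_square field_simps)
  qed
  also have "\<dots> < 0"
    using \<open>a \<noteq> 0\<close> by (simp add: d_def add_nonneg_pos)
  finally show False by simp
qed

text \<open>The quadratic form of \<open>f\<close> attains its maximum \<open>l\<close> on the
  compact unit sphere of \<open>V\<close>. A maximiser is an eigenvector by the first-order
  condition; invariance of \<open>V\<close> keeps the direction of variation inside
  \<open>V\<close>.\<close>

lemma Rayleigh_max_eigenvector:
  fixes f :: "'a::euclidean_space \<Rightarrow> 'a"
  assumes lin: "linear f" and sym: "\<And>u v. f u \<bullet> v = u \<bullet> f v"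
    and V: "subspace V" "\<And>v. v \<in> V \<Longrightarrow> f v \<in> V" and nz: "v\<^sub>0 \<in> V" "v\<^sub>0 \<noteq> 0"
  obtains e l where "e \<in> V" "e \<noteq> 0" "f e = l *\<^sub>R e" "\<And>v. v \<in> V \<Longrightarrow> v \<bullet> f v \<le> l * (v \<bullet> v)"
proof -
  have "compact (sphere 0 1 \<inter> V)"
    by (intro compact_Int_closed compact_sphere closed_subspace V)
  moreover have "(1 / norm v\<^sub>0) *\<^sub>R v\<^sub>0 \<in> sphere 0 1 \<inter> V"
    using nz V by (simp add: subspace_scale)
  moreover have "continuous_on (sphere 0 1 \<inter> V) (\<lambda>v. v \<bullet> f v)"
    by (intro continuous_intros linear_continuous_on)
      (simp add: lin linear_conv_bounded_linear[symmetric])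
  ultimately obtain e where e: "e \<in> V" "norm e = 1"
    and max: "\<And>v. v \<in> V \<Longrightarrow> norm v = 1 \<Longrightarrow> v \<bullet> f v \<le> e \<bullet> f e"
    using continuous_attains_sup[of "sphere 0 1 \<inter> V" "\<lambda>v. v \<bullet> f v"]
    by (metis (no_types, lifting) IntD1 IntD2 IntI empty_iff mem_sphere_0)
  define l where "l = e \<bullet> f e"
  have le: "v \<bullet> f v \<le> l * (v \<bullet> v)" if v: "v \<in> V" for v
  proof (cases "v = 0")
    case False
    define u where "u = (1 / norm v) *\<^sub>R v"
    have u: "u \<in> V" "norm u = 1" "v = norm v *\<^sub>R u"
      using v False V by (simp_all add: u_def subspace_scale)
    have "v \<bullet> f v = (norm v)\<^sup>2 * (u \<bullet> f u)"
      by (subst (1 2) u(3)) (simp add: linear_scale[OF lin] power2_eq_square)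
    also have "\<dots> \<le> (norm v)\<^sup>2 * l"
      unfolding l_def using max[OF u(1,2)] by (intro mult_left_mono) auto
    finally show ?thesis
      by (simp add: power2_norm_eq_inner mult.commute)
  qed (simp add: linear_0[OF lin])
  \<comment> \<open>Half the gradient at \<open>e\<close> of
    \<open>l * (v \<bullet> v) - v \<bullet> f v\<close>. This expression is nonnegative on
    \<open>V\<close> and vanishes at \<open>e\<close>; along \<open>e + t *\<^sub>R w\<close> its
    linear coefficient is \<open>2 * (w \<bullet> w)\<close>, which must therefore be zero.\<close>
  define w where "w = l *\<^sub>R e - f e"
  have w: "w \<in> V"
    unfolding w_def using e(1) V by (intro subspace_diff subspace_scale) auto
  have "0 \<le> 2 * t * (w \<bullet> w) + t\<^sup>2 * (l * (w \<bullet> w) - w \<bullet> f w)" for t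
  proof -
    have "e + t *\<^sub>R w \<in> V"
      using e(1) w V by (intro subspace_add subspace_scale)
    from le[OF this] have
      "0 \<le> l * ((e + t *\<^sub>R w) \<bullet> (e + t *\<^sub>R w)) - (e + t *\<^sub>R w) \<bullet> f (e + t *\<^sub>R w)"
      by simp
    also have "\<dots> = (l * (e \<bullet> e) - e \<bullet> f e) + 2 * t * ((l *\<^sub>R e - f e) \<bullet> w)
        + t\<^sup>2 * (l * (w \<bullet> w) - w \<bullet> f w)"
    proof -
      have "w \<bullet> e = e \<bullet> w" and "w \<bullet> f e = f e \<bullet> w" and "e \<bullet> f w = f e \<bullet> w"
        by (rule inner_commute, rule inner_commute, rule sym[symmetric])
      then show ?thesis
        unfolding linear_add[OF lin] linear_scale[OF lin] inner_add_left inner_add_right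
          inner_diff_left inner_scaleR_left inner_scaleR_right
        by (simp add: power2_eq_square algebra_simps)
    qed
    also have "l * (e \<bullet> e) - e \<bullet> f e = 0"
      using e(2) by (simp add: l_def norm_eq_1)
    finally show ?thesis
      by (simp add: w_def)
  qed
  then have "w \<bullet> w = 0"
    by (rule quadratic_nonneg_imp_linear_coeff_0)
  then have "f e = l *\<^sub>R e"
    by (simp add: w_def)
  moreover have "e \<noteq> 0"
    using e(2) by auto
  ultimately show ?thesis
    using that e(1) le by blast
qed

text \<open>
  The largest eigenvalue of \<open>f\<^sup>2\<close> has the form \<open>s\<^sup>2\<close>, and \<open>(f - s) (f + s) e = 0\<close> for an eigenvector
  \<open>e\<close>, so that \<open>s\<close> or \<open>- s\<close> is an eigenvalue of \<open>f\<close>.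
\<close>

lemma norm_le_if_eigenvalues_bounded:
  fixes f :: "'a::euclidean_space \<Rightarrow> 'a"
  assumes lin: "linear f" and sym: "\<And>u v. f u \<bullet> v = u \<bullet> f v"
    and V: "subspace V" "\<And>v. v \<in> V \<Longrightarrow> f v \<in> V"
    and bound: "\<And>e l. e \<in> V \<Longrightarrow> e \<noteq> 0 \<Longrightarrow> f e = l *\<^sub>R e \<Longrightarrow> \<bar>l\<bar> \<le> r"
    and v: "v \<in> V"
  shows "norm (f v) \<le> r * norm v"
proof (cases "v = 0")
  case False
  have "linear (\<lambda>v. f (f v))"
    using linear_compose[OF lin lin] by (simp add: o_def)
  moreover have "f (f u) \<bullet> w = u \<bullet> f (f w)" for u w
    by (simp add: sym)
  moreover have "f (f u) \<in> V" if "u \<in> V" for u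
    using V(2) that by blast
  ultimately obtain e m where e: "e \<in> V" "e \<noteq> 0" "f (f e) = m *\<^sub>R e"
    and le: "\<And>u. u \<in> V \<Longrightarrow> u \<bullet> f (f u) \<le> m * (u \<bullet> u)"
    using Rayleigh_max_eigenvector[of "\<lambda>v. f (f v)" V v] V(1) v False by metis
  define s where "s = sqrt m"
  \<comment> \<open>Makes \<open>m\<close> a quotient of squared norms, hence nonnegative, so that
    \<open>s * s = m\<close>.\<close>
  have "m * (e \<bullet> e) = f e \<bullet> f e"
    using e(3) by (simp add: sym)
  then have "0 \<le> m * (e \<bullet> e)"
    by simp
  then have "0 \<le> m"
    using e(2) by (intro mult_right_le_imp_le[of 0 "e \<bullet> e" m]) simp_all
  then have s: "0 \<le> s" "s * s = m"
    by (simp_all add: s_def)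
  have "s \<le> r"
  proof (cases "f e + s *\<^sub>R e = 0")
    case True
    then have "f e = (- s) *\<^sub>R e"
      by (simp add: eq_neg_iff_add_eq_0)
    then show ?thesis
      using bound[OF e(1,2)] s(1) by fastforce
  next
    case False
    have "f (f e + s *\<^sub>R e) = s *\<^sub>R (f e + s *\<^sub>R e)"
      by (simp add: linear_add[OF lin] linear_scale[OF lin] e(3) s(2)[symmetric] algebra_simps)
    moreover have "f e + s *\<^sub>R e \<in> V"
      using e(1) V by (intro subspace_add subspace_scale) auto
    ultimately show ?thesis
      using bound[of "f e + s *\<^sub>R e" s] False s(1) by simp
  qed
  have "(norm (f v))\<^sup>2 = v \<bullet> f (f v)"
    by (simp add: power2_norm_eq_inner sym)
  also have "\<dots> \<le> m * (v \<bullet> v)"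
    by (rule le[OF v])
  also have "\<dots> = (s * norm v)\<^sup>2"
    using s(2) by (simp add: power2_norm_eq_inner power_mult_distrib) (simp add: power2_eq_square)
  finally have "norm (f v) \<le> s * norm v"
    using s(1) by (auto intro: power2_le_imp_le)
  also have "\<dots> \<le> r * norm v"
    using \<open>s \<le> r\<close> by (simp add: mult_right_mono)
  finally show ?thesis .
qed (simp add: linear_0[OF lin])

text \<open>Eigenvectors for distinct eigenvalues are orthogonal, and a pairwise orthogonal set in
  finite dimension is finite; \<open>g\<close> picks one eigenvector per eigenvalue. Finiteness is
  what makes \<open>Max\<close> and \<open>Min\<close> of the singular values meaningful.\<close>

lemma finite_eigenvalues:
  fixes f :: "'a::euclidean_space \<Rightarrow> 'a"
  assumes sym: "\<And>u v. f u \<bullet> v = u \<bullet> f v"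
  shows "finite {l. \<exists>v. v \<noteq> 0 \<and> f v = l *\<^sub>R v}" (is "finite ?L")
proof -
  define g where "g l = (SOME v. v \<noteq> 0 \<and> f v = l *\<^sub>R v)" for l
  have g: "g l \<noteq> 0 \<and> f (g l) = l *\<^sub>R g l" if "l \<in> ?L" for l
    unfolding g_def by (rule someI_ex) (use that in simp)
  have "pairwise orthogonal (g ` ?L)"
  proof (clarsimp simp: pairwise_def)
    fix l v l' v' assume "v \<noteq> 0" "f v = l *\<^sub>R v" "v' \<noteq> 0" "f v' = l' *\<^sub>R v'" "g l \<noteq> g l'"
    then have "f (g l) = l *\<^sub>R g l" "f (g l') = l' *\<^sub>R g l'" "l \<noteq> l'"
      using g[of l] g[of l'] by auto
    then show "orthogonal (g l) (g l')"
      using sym[of "g l" "g l'"] by (simp add: orthogonal_def)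
  qed
  then have "finite (g ` ?L)"
    by (rule pairwise_orthogonal_imp_finite)
  moreover have "inj_on g ?L"
  proof (rule inj_onI)
    fix l l' assume *: "l \<in> ?L" "l' \<in> ?L" "g l = g l'"
    have "l *\<^sub>R g l = l' *\<^sub>R g l"
      using g[OF *(1)] g[OF *(2)] unfolding *(3)[symmetric] by simp
    then show "l = l'"
      using g[OF *(1)] by simp
  qed
  ultimately show ?thesis
    by (rule finite_imageD)
qed

section \<open>Singular values and the contraction on the row space\<close>

lemma finite_singular_values:
  fixes A :: "real ^ 'n ^ 'm"
  shows "finite (singular_values A)"
  unfolding singular_values_def setcompr_eq_image
  by (intro finite_imageI finite_eigenvalues gram_symmetric)

text \<open>\<open>sqrt\<close> is odd in HOL, so the sign of the eigenvalue \<open>l\<close>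
  matters; \<open>l * (v \<bullet> v)\<close> is the squared norm of \<open>A *v v\<close>.\<close>

lemma singular_values_nonneg:
  fixes A :: "real ^ 'n ^ 'm"
  assumes "s \<in> singular_values A"
  shows "0 \<le> s"
proof -
  obtain l v where s: "s = sqrt l" and v: "v \<noteq> 0" "(transpose A ** A) *v v = l *\<^sub>R v"
    using assms unfolding singular_values_def by blast
  have "0 \<le> l * (v \<bullet> v)"
    unfolding gram_eigenvector_inner[OF v(2), symmetric] by simp
  then have "0 \<le> l"
    using v(1) by (intro mult_right_le_imp_le[of 0 "v \<bullet> v" l]) simp_all
  then show ?thesis
    by (simp add: s)
qed

text \<open>A nonzero vector of the row space is not in the kernel of \<open>A\<close>, so
  \<open>l\<close> is positive and \<open>sqrt l\<close> is a nonzero singular value, to which both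
  extremes can be compared.\<close>

lemma gram_eigenvalue_bounds:
  fixes A :: "real ^ 'n ^ 'm"
  assumes e: "(transpose A ** A) *v e = l *\<^sub>R e" "e \<in> range ((*v) (transpose A))" "e \<noteq> 0"
  shows "(sigma_min A)\<^sup>2 \<le> l" and "l \<le> (sigma_max A)\<^sup>2"
proof -
  have "A *v e \<noteq> 0"
    using e(2,3) row_range_kernel by blast
  then have "0 < l * (e \<bullet> e)"
    unfolding gram_eigenvector_inner[OF e(1), symmetric] by simp
  then have "0 < l"
    by (rule zero_less_mult_pos2) (use e(3) in simp)
  have sv: "sqrt l \<in> singular_values A"
    unfolding singular_values_def using e by blast
  then have "sqrt l \<in> singular_values A - {0}"
    using \<open>0 < l\<close> by simp
  then have "sigma_min A \<le> sqrt l" and min: "sigma_min A \<in> singular_values A - {0}"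
    unfolding sigma_min_def using finite_singular_values[of A]
    by (auto intro!: Min_le Min_in simp del: Diff_iff)
  moreover have "0 \<le> sigma_min A"
    using min singular_values_nonneg by blast
  ultimately have "(sigma_min A)\<^sup>2 \<le> (sqrt l)\<^sup>2"
    by (intro power_mono)
  then show "(sigma_min A)\<^sup>2 \<le> l"
    using \<open>0 < l\<close> by simp
  have "sqrt l \<le> sigma_max A"
    unfolding sigma_max_def using sv finite_singular_values by (intro Max_ge)
  then have "(sqrt l)\<^sup>2 \<le> (sigma_max A)\<^sup>2"
    using \<open>0 < l\<close> by (intro power_mono) auto
  then show "l \<le> (sigma_max A)\<^sup>2"
    using \<open>0 < l\<close> by simp
qed

text \<open>If the step map has eigenvalue \<open>l\<close> on the row space, the Gram matrix has
  eigenvalue \<open>(1 - l) / c\<close> there. Its upper bound and the limit on \<open>c\<close>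
  give \<open>0 \<le> l\<close>; its lower bound gives the rate.\<close>

lemma gradient_step_contraction:
  fixes A :: "real ^ 'n ^ 'm"
  assumes c: "0 \<le> c" "c * (sigma_max A)\<^sup>2 \<le> 1" and v: "v \<in> range ((*v) (transpose A))"
  shows "norm (v - c *\<^sub>R ((transpose A ** A) *v v)) \<le> (1 - c * (sigma_min A)\<^sup>2) * norm v"
proof (rule norm_le_if_eigenvalues_bounded[where V = "range ((*v) (transpose A))"])
  let ?K = "transpose A ** A" and ?V = "range ((*v) (transpose A))"
  show "linear (\<lambda>v. v - c *\<^sub>R (?K *v v))"
    by (intro linear_compose_sub linear_compose_scale_right linear_ident matrix_vector_mul_linear)
  show "(u - c *\<^sub>R (?K *v u)) \<bullet> w = u \<bullet> (w - c *\<^sub>R (?K *v w))" for u w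
    by (simp add: inner_diff_left inner_diff_right gram_symmetric)
  show "subspace ?V"
    by (rule subspace_row_range)
  show "u - c *\<^sub>R (?K *v u) \<in> ?V" if "u \<in> ?V" for u
    using that by (intro subspace_diff subspace_scale subspace_row_range) (auto simp: gram_mult_vec)
  show "v \<in> ?V"
    by (rule v)
  show "\<bar>l\<bar> \<le> 1 - c * (sigma_min A)\<^sup>2"
    if e: "e \<in> ?V" "e \<noteq> 0" "e - c *\<^sub>R (?K *v e) = l *\<^sub>R e" for e l
  \<comment> \<open>For \<open>c = 0\<close> the step map is the identity; otherwise dividing by
    \<open>c\<close> is legitimate.\<close>
  proof (cases "c = 0")
    case True
    then have "l = 1"
      using e by (metis diff_zero scaleR_cancel_right scaleR_one scaleR_zero_left)
    then show ?thesis
      using True by simp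
  next
    case False
    have "c *\<^sub>R (?K *v e) = (1 - l) *\<^sub>R e"
      using e(3) by (simp add: algebra_simps)
    then have "?K *v e = ((1 - l) / c) *\<^sub>R e"
      using False by (simp add: eq_vector_fraction_iff)
    from gram_eigenvalue_bounds[OF this e(1,2)]
    have "c * (sigma_min A)\<^sup>2 \<le> 1 - l" "1 - l \<le> c * (sigma_max A)\<^sup>2"
      using False c(1) by (simp_all add: field_simps)
    then show ?thesis
      using c(2) by simp
  qed
qed

section \<open>Expectation of a product of independent factors\<close>

lemma borel_measurable_vec_nth [measurable]:
  "(\<lambda>v :: 'a::euclidean_space ^ 'n. v $ i) \<in> borel_measurable borel"
  by (intro borel_measurable_continuous_onI continuous_intros)

lemma borel_measurable_matrix_vector_mult [measurable]:
  fixes W :: "'a \<Rightarrow> real ^ 'n ^ 'm" and v :: "'a \<Rightarrow> real ^ 'n"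
  assumes [measurable]: "W \<in> borel_measurable M" "v \<in> borel_measurable M"
  shows "(\<lambda>x. W x *v v x) \<in> borel_measurable M"
proof -
  have "continuous_on UNIV (\<lambda>p :: (real ^ 'n ^ 'm) \<times> (real ^ 'n). fst p *v snd p)"
    unfolding matrix_vector_mult_def by (intro continuous_intros)
  then show ?thesis
    using borel_measurable_continuous_Pair[of W M v "\<lambda>W v. W *v v"] by simp
qed

text \<open>The product only multiplies an entry in column \<open>j\<close> of \<open>W\<close> by
  coordinate \<open>j\<close> of \<open>v\<close>, so the scalar product rule for independent
  variables applies term by term.\<close>

lemma (in prob_space)
  fixes W :: "'a \<Rightarrow> real ^ 'n ^ 'm" and v :: "'a \<Rightarrow> real ^ 'n"
  assumes ind: "\<And>i j. indep_var borel (\<lambda>\<omega>. W \<omega> $ i $ j) borel (\<lambda>\<omega>. v \<omega> $ j)"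
    and int: "integrable M W" "integrable M v"
  shows integrable_indep_matrix_vector_mult: "integrable M (\<lambda>\<omega>. W \<omega> *v v \<omega>)"
    and integral_indep_matrix_vector_mult:
      "(\<integral>\<omega>. W \<omega> *v v \<omega> \<partial>M) = (\<integral>\<omega>. W \<omega> \<partial>M) *v (\<integral>\<omega>. v \<omega> \<partial>M)"
proof -
  have entries: "bounded_linear (\<lambda>W :: real ^ 'n ^ 'm. W $ i $ j)" for i j
    by (intro bounded_linear_compose[OF bounded_linear_vec_nth bounded_linear_vec_nth])
  have W: "integrable M (\<lambda>\<omega>. W \<omega> $ i $ j)" "(\<integral>\<omega>. W \<omega> $ i $ j \<partial>M) = (\<integral>\<omega>. W \<omega> \<partial>M) $ i $ j" for i j
    using integrable_bounded_linear[OF entries int(1)] integral_bounded_linear[OF entries int(1)]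
    by auto
  have v: "integrable M (\<lambda>\<omega>. v \<omega> $ j)" "(\<integral>\<omega>. v \<omega> $ j \<partial>M) = (\<integral>\<omega>. v \<omega> \<partial>M) $ j" for j
    using integrable_bounded_linear[OF bounded_linear_vec_nth int(2)]
      integral_bounded_linear[OF bounded_linear_vec_nth int(2)] by auto
  note prod = indep_var_integrable[OF ind W(1) v(1)] indep_var_lebesgue_integral[OF ind W(1) v(1)]
  \<comment> \<open>A finite sum of scalar products times fixed basis vectors, so that integrability
    and the integral pass to the summands.\<close>
  have expand: "B *v u = (\<Sum>i\<in>UNIV. \<Sum>j\<in>UNIV. (B $ i $ j * u $ j) *\<^sub>R axis i 1)"
    for B :: "real ^ 'n ^ 'm" and u
  proof (rule vec_eq_iff[THEN iffD2], rule allI)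
    fix k
    have "(\<Sum>i\<in>UNIV. \<Sum>j\<in>UNIV. (B $ i $ j * u $ j) *\<^sub>R axis i 1) $ k
        = (\<Sum>i\<in>UNIV. if i = k then \<Sum>j\<in>UNIV. B $ i $ j * u $ j else 0)"
      unfolding sum_component by (intro sum.cong refl) (simp add: axis_def)
    then show "(B *v u) $ k = (\<Sum>i\<in>UNIV. \<Sum>j\<in>UNIV. (B $ i $ j * u $ j) *\<^sub>R axis i 1) $ k"
      by (simp add: matrix_vector_mult_def)
  qed
  show "integrable M (\<lambda>\<omega>. W \<omega> *v v \<omega>)"
    unfolding expand by (intro Bochner_Integration.integrable_sum integrable_scaleR_left prod)
  show "(\<integral>\<omega>. W \<omega> *v v \<omega> \<partial>M) = (\<integral>\<omega>. W \<omega> \<partial>M) *v (\<integral>\<omega>. v \<omega> \<partial>M)"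
    unfolding expand by (simp add: Bochner_Integration.integral_sum prod W v)
qed

section \<open>The iterates as functions of the earlier draws\<close>

text \<open>Lets the iterate be evaluated on the draws restricted to \<open>{..<k}\<close>, as the
  independence argument requires.\<close>

lemma pfr_cong:
  assumes "\<And>j. j < k \<Longrightarrow> q j = q' j"
  shows "pfr A b \<alpha> x\<^sub>0 q k = pfr A b \<alpha> x\<^sub>0 q' k"
  using assms by (induction k) auto

text \<open>The index set \<open>{..<n}\<close> stays fixed while \<open>k\<close> grows, so that
  the induction takes place over a single product space.\<close>

lemma measurable_pfr:
  fixes A :: "real ^ 'n ^ 'm"
  assumes [measurable]: "pfr_matrix A \<in> borel_measurable quad_space" and "k \<le> n"
  shows "(\<lambda>q. pfr A b \<alpha> x\<^sub>0 q k) \<in> borel_measurable (PiM {..<n} (\<lambda>_. quad_space))"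
  using \<open>k \<le> n\<close>
proof (induction k)
  case (Suc k)
  then have [measurable]:
    "(\<lambda>q. pfr A b \<alpha> x\<^sub>0 q k) \<in> borel_measurable (PiM {..<n} (\<lambda>_. quad_space))" by simp
  have [measurable]: "k \<in> {..<n}" using Suc by simp
  show ?case
    by simp
qed simp

section \<open>Decay of the mean error\<close>

theorem theorem3p2:
  fixes A :: "real ^ 'n ^ 'm"
    and b :: "real ^ 'm"
    and D :: "('m, 'n) quad measure"
    and x\<^sub>0 x\<^sub>s :: "real ^ 'n"
    and \<alpha> :: real
    and M :: "'w measure"
    and q :: "nat \<Rightarrow> 'w \<Rightarrow> ('m, 'n) quad"
    and x :: "nat \<Rightarrow> 'w \<Rightarrow> real ^ 'n"
  assumes "A \<noteq> 0"
    and "prob_space D"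
    and "sets D = sets quad_space"
    and "integrable D (pfr_matrix A)"
    and "(\<integral>Q. pfr_matrix A Q \<partial>D) = (1 / (norm A)\<^sup>2) *\<^sub>R transpose A"
    and "prob_space M"
    and "prob_space.indep_vars M (\<lambda>_. quad_space) q UNIV"
    and "\<And>k. distr M quad_space (q k) = D"
    and "\<And>k \<omega>. x k \<omega> = pfr A b \<alpha> x\<^sub>0 (\<lambda>j. q j \<omega>) k"
    and "x\<^sub>s = pinv A *v b + (mat 1 - pinv A ** A) *v x\<^sub>0"
    and "\<And>k. integrable M (\<lambda>\<omega>. x k \<omega> - x\<^sub>s)"
    and "0 < \<alpha>"
    and "\<alpha> \<le> (norm A)\<^sup>2 / (sigma_max A)\<^sup>2"
  shows "\<forall>k\<ge>1. (norm (\<integral>\<omega>. (x k \<omega> - x\<^sub>s) \<partial>M))\<^sup>2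
           \<le> (1 - \<alpha> * (sigma_min A)\<^sup>2 / (norm A)\<^sup>2) ^ (2 * k) * (norm (x\<^sub>0 - x\<^sub>s))\<^sup>2"
proof (intro allI impI)
  interpret prob_space M by fact
  define c where "c = \<alpha> / (norm A)\<^sup>2"
  define r where "r = 1 - c * (sigma_min A)\<^sup>2"
  define W where "W k \<omega> = pfr_matrix A (q k \<omega>)" for k \<omega>
  define y where "y k \<omega> = x k \<omega> - x\<^sub>s" for k \<omega>
  let ?V = "range ((*v) (transpose A))"
  \<comment> \<open>The bound on \<open>\<alpha>\<close> has \<open>(sigma_max A)\<^sup>2\<close> as
    denominator; the case where it is zero is split off before denominators are cleared.\<close>
  have c: "0 \<le> c" "c * (sigma_max A)\<^sup>2 \<le> 1"
    using \<open>0 < \<alpha>\<close> \<open>\<alpha> \<le> _\<close> \<open>A \<noteq> 0\<close>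
    by (cases "sigma_max A = 0"; simp add: c_def field_simps)+
  have [measurable]: "pfr_matrix A \<in> borel_measurable quad_space"
    using borel_measurable_integrable[OF assms(4)] measurable_cong_sets[OF assms(3) refl] by blast
  have [measurable]: "q k \<in> M \<rightarrow>\<^sub>M quad_space" for k
    using assms(7) by (simp add: indep_vars_def)
  \<comment> \<open>\<open>q k\<close> has law \<open>D\<close>, so the moments of
    \<open>pfr_matrix A\<close> under \<open>D\<close> transfer to \<open>M\<close>.\<close>
  have W_int: "integrable M (W k)" for k
    unfolding W_def using assms(4) assms(8)[of k]
    by (subst integrable_distr_eq[where N = quad_space, symmetric]) auto
  have W_mean: "(\<integral>\<omega>. W k \<omega> \<partial>M) = (1 / (norm A)\<^sup>2) *\<^sub>R transpose A" for k
    unfolding W_def using assms(5) assms(8)[of k]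
    by (subst integral_distr[where N = quad_space, symmetric]) auto
  have y_int: "integrable M (y k)" for k
    using assms(11)[of k] unfolding y_def .
  \<comment> \<open>The constant part \<open>A *v x\<^sub>s - b\<close> may be nonzero for an
    inconsistent system; it vanishes only after multiplication by
    \<open>transpose A\<close>.\<close>
  have res: "A *v x k \<omega> - b = A *v y k \<omega> + (A *v x\<^sub>s - b)" for k \<omega>
    by (simp add: y_def matrix_vector_mult_diff_distrib)
  have Ay_int: "integrable M (\<lambda>\<omega>. A *v y k \<omega>)"
    and Ay_mean: "(\<integral>\<omega>. A *v y k \<omega> \<partial>M) = A *v (\<integral>\<omega>. y k \<omega> \<partial>M)" for k
    using integrable_bounded_linear[OF matrix_vector_mul_bounded_linear y_int[of k]]
      integral_bounded_linear[OF matrix_vector_mul_bounded_linear y_int[of k]] by auto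
  have res_int: "integrable M (\<lambda>\<omega>. A *v x k \<omega> - b)" for k
    unfolding res using Ay_int by simp
  have res_mean: "(\<integral>\<omega>. A *v x k \<omega> - b \<partial>M) = A *v (\<integral>\<omega>. y k \<omega> \<partial>M) + (A *v x\<^sub>s - b)" for k
    unfolding res using Ay_int by (simp add: Ay_mean prob_space)
  have indep: "indep_var borel (\<lambda>\<omega>. W k \<omega> $ i $ j) borel (\<lambda>\<omega>. (A *v x k \<omega> - b) $ j)" for i j k
  proof -
    \<comment> \<open>The families of draws over the disjoint index sets \<open>{k}\<close> and
      \<open>{..<k}\<close> are independent; the first determines \<open>W k\<close>, the second
      determines \<open>x k\<close>.\<close>
    have "indep_var (PiM {k} (\<lambda>_. quad_space)) (\<lambda>\<omega>. restrict (\<lambda>j. q j \<omega>) {k})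
        (PiM {..<k} (\<lambda>_. quad_space)) (\<lambda>\<omega>. restrict (\<lambda>j. q j \<omega>) {..<k})"
      by (rule indep_var_restrict[OF assms(7)]) auto
    moreover have "(\<lambda>p. pfr_matrix A (p k) $ i $ j) \<in> borel_measurable (PiM {k} (\<lambda>_. quad_space))"
      by measurable
    moreover have "(\<lambda>p. (A *v pfr A b \<alpha> x\<^sub>0 p k - b) $ j)
        \<in> borel_measurable (PiM {..<k} (\<lambda>_. quad_space))"
    proof -
      have [measurable]:
        "(\<lambda>p. pfr A b \<alpha> x\<^sub>0 p k) \<in> borel_measurable (PiM {..<k} (\<lambda>_. quad_space))"
        by (rule measurable_pfr) simp_all
      show ?thesis
        by measurable
    qed
    ultimately have "indep_var borel ((\<lambda>p. pfr_matrix A (p k) $ i $ j) \<circ> (\<lambda>\<omega>. restrict (\<lambda>j. q j \<omega>) {k}))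
       borel ((\<lambda>p. (A *v pfr A b \<alpha> x\<^sub>0 p k - b) $ j) \<circ> (\<lambda>\<omega>. restrict (\<lambda>j. q j \<omega>) {..<k}))"
      by (rule indep_var_compose)
    moreover have "pfr A b \<alpha> x\<^sub>0 (restrict (\<lambda>j. q j \<omega>) {..<k}) k = x k \<omega>" for \<omega>
      unfolding assms(9) by (rule pfr_cong) simp
    ultimately show ?thesis
      by (simp add: o_def W_def)
  qed
  have x\<^sub>0: "x\<^sub>0 - x\<^sub>s = pinv A *v (A *v x\<^sub>0 - b)"
    by (simp add: assms(10) matrix_vector_mult_diff_distrib matrix_vector_mult_diff_rdistrib
        matrix_vector_mul_assoc)
  have res_s: "transpose A *v (A *v x\<^sub>s - b) = 0"
  proof -
    \<comment> \<open>The kernel component of \<open>x\<^sub>s\<close> contributes nothing, which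
      leaves the normal equations for \<open>pinv A *v b\<close>.\<close>
    have "A *v x\<^sub>s = A *v (pinv A *v b) + (A *v x\<^sub>0 - (A ** pinv A ** A) *v x\<^sub>0)"
      by (simp add: assms(10) matrix_vector_right_distrib matrix_vector_mult_diff_distrib
          matrix_vector_mult_diff_rdistrib matrix_vector_mul_assoc matrix_mul_assoc)
    also have "A ** pinv A ** A = A"
      using is_pinv_pinv[of A] by (simp add: is_pinv_def)
    finally show ?thesis
      using transpose_pinv_residual[of A b] by simp
  qed
  have step: "(\<integral>\<omega>. y (Suc k) \<omega> \<partial>M)
      = (\<integral>\<omega>. y k \<omega> \<partial>M) - c *\<^sub>R ((transpose A ** A) *v (\<integral>\<omega>. y k \<omega> \<partial>M))" for k
  proof -
    note Wres = integrable_indep_matrix_vector_mult[OF indep W_int res_int]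
      integral_indep_matrix_vector_mult[OF indep W_int res_int]
    have "y (Suc k) \<omega> = y k \<omega> - \<alpha> *\<^sub>R (W k \<omega> *v (A *v x k \<omega> - b))" for \<omega>
      by (simp add: y_def W_def assms(9))
    then have "(\<integral>\<omega>. y (Suc k) \<omega> \<partial>M) = (\<integral>\<omega>. y k \<omega> \<partial>M)
        - \<alpha> *\<^sub>R (((1 / (norm A)\<^sup>2) *\<^sub>R transpose A)
             *v (A *v (\<integral>\<omega>. y k \<omega> \<partial>M) + (A *v x\<^sub>s - b)))"
      using y_int Wres by (simp add: W_mean res_mean)
    then show ?thesis
      using res_s by (simp add: scaleR_matrix_vector_assoc[symmetric] matrix_vector_right_distrib
          gram_mult_vec c_def)
  qed
  \<comment> \<open>To see that \<open>r\<close> is nonnegative, apply the contraction to a nonzero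
    vector of the row space: \<open>r\<close> times a positive norm bounds a norm. The induction
    below multiplies inequalities by \<open>r\<close>.\<close>
  have "transpose A \<noteq> 0"
    using \<open>A \<noteq> 0\<close> by (auto simp: transpose_def vec_eq_iff)
  then obtain u where "transpose A *v u \<noteq> 0"
    by (metis matrix_eq matrix_vector_mult_0)
  moreover have "0 \<le> r * norm (transpose A *v u)"
    using order_trans[OF norm_ge_zero gradient_step_contraction[OF c rangeI]] by (simp add: r_def)
  ultimately have r: "0 \<le> r"
    by (simp add: zero_le_mult_iff)
  \<comment> \<open>Membership in the row space is carried along because the contraction holds only
    there.\<close>
  have mean: "(\<integral>\<omega>. y k \<omega> \<partial>M) \<in> ?V \<and> norm (\<integral>\<omega>. y k \<omega> \<partial>M) \<le> r ^ k * norm (x\<^sub>0 - x\<^sub>s)" for k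
  proof (induction k)
    case 0
    have "(\<integral>\<omega>. y 0 \<omega> \<partial>M) = x\<^sub>0 - x\<^sub>s"
      by (simp add: y_def assms(9) prob_space)
    then show ?case
      using pinv_in_row_range[of A "A *v x\<^sub>0 - b"] x\<^sub>0 by simp
  next
    case (Suc k)
    let ?e = "\<integral>\<omega>. y k \<omega> \<partial>M"
    have "norm (\<integral>\<omega>. y (Suc k) \<omega> \<partial>M) \<le> r * norm ?e"
      unfolding step r_def using Suc by (intro gradient_step_contraction c) auto
    also have "\<dots> \<le> r * (r ^ k * norm (x\<^sub>0 - x\<^sub>s))"
      using Suc r by (intro mult_left_mono) auto
    moreover have "(\<integral>\<omega>. y (Suc k) \<omega> \<partial>M) \<in> ?V"
      unfolding step using Suc
      by (intro subspace_diff subspace_scale subspace_row_range) (auto simp: gram_mult_vec)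
    ultimately show ?case
      by (simp add: mult.assoc)
  qed
  fix k :: nat
  have "(norm (\<integral>\<omega>. y k \<omega> \<partial>M))\<^sup>2 \<le> (r ^ k * norm (x\<^sub>0 - x\<^sub>s))\<^sup>2"
    using mean by (intro power_mono) auto
  also have "\<dots> = r ^ (2 * k) * (norm (x\<^sub>0 - x\<^sub>s))\<^sup>2"
    by (simp add: power_mult_distrib mult.commute flip: power_mult)
  finally show "(norm (\<integral>\<omega>. (x k \<omega> - x\<^sub>s) \<partial>M))\<^sup>2
      \<le> (1 - \<alpha> * (sigma_min A)\<^sup>2 / (norm A)\<^sup>2) ^ (2 * k) * (norm (x\<^sub>0 - x\<^sub>s))\<^sup>2"
    by (simp add: y_def r_def c_def)
qed

end
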